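(* On the square board $[0,1]^2$, a piece $\mathsf P$ has denominator $D_q(\mathsf P)=1$ for all $q\ge1$ if and only if it is one of the following four pieces: the rook (basic moves $(1,0)$ and $(0,1)$), the semirook (one basic move, either $(1,0)$ or $(0,1)$), the semibishop (one basic move, either $(1,1)$ or $(1,-1)$), or the anassa (two basic moves, one from $\{(1,0),(0,1)\}$ and one from $\{(1,1),(1,-1)\}$). For these four pieces the counting function $u_{\mathsf P}(q;n)$ is a polynomial in $n$.
   Context: A piece $\mathsf P$ is given by a finite set of basic moves: nonzero vectors $m=(c,d)\in\mathbb Z^2$ with $\gcd(c,d)=1$, no one a scalar multiple of another (so a move and its negative are the same basic move). Two pieces at positions $z,z'\in\mathbb Z^2$ attack each other if $z'-z$ is an integer multiple (possibly zero) of some basic move. The counting function $u_{\mathsf P}(q;n)$ is the number of ways to place $q$ unlabelled pieces on the $n\times n$ board $\{1,\dots,n\}^2$ so that no two attack each other. For $q$ pieces, configurations are points $\mathbf z=(z_1,\dots,z_q)\in\mathbb R^{2q}$; for each basic move $m=(c,d)$ and $1\le i<j\le q$ the move hyperplane is $\mathcal H^m_{ij}=\{\mathbf z:(z_j-z_i)\cdot(d,-c)=0\}$, forming the arrangement $\mathcal A^q_{\mathsf P}$. A vertex of the inside-out polytope $([0,1]^{2q},\mathcal A^q_{\mathsf P})$ is a point of $[0,1]^{2q}$ that is the unique point of an intersection of move hyperplanes and facet hyperplanes $x_i=0$, $x_i=1$, $y_i=0$, $y_i=1$. The denominator $D_q(\mathsf P)$ is the least common multiple, over all vertices, of the least common denominator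 of the vertex's coordinates. *)

theory Defs
  imports "HOL-Analysis.Analysis" "HOL-Computational_Algebra.Polynomial"
begin

type_synonym move = "int \<times> int"

text \<open>
  A piece is represented by its set of basic moves, with one representative of each pair
  \<open>{m, -m}\<close>.  The set is required to be nonempty: without moves nothing attacks anything, and the
  arrangement of move hyperplanes is empty.  \<open>coprime c d\<close> already excludes the zero vector.
\<close>
definition piece :: "move set \<Rightarrow> bool" where
  "piece M \<longleftrightarrow> finite M \<and> M \<noteq> {} \<and>
     (\<forall>(c, d)\<in>M. coprime c d) \<and>
     (\<forall>(c, d)\<in>M. \<forall>(c', d')\<in>M. (c, d) \<noteq> (c', d') \<longrightarrow>
        \<not> (\<exists>r::real. real_of_int c' = r * real_of_int c \<and> real_of_int d' = r * real_of_int d))"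

text \<open>Equality of pieces: equality of the sets of basic moves up to the sign of each move.\<close>
definition same_piece :: "move set \<Rightarrow> move set \<Rightarrow> bool" where
  "same_piece M N \<longleftrightarrow> M \<union> uminus ` M = N \<union> uminus ` N"

definition rook :: "move set \<Rightarrow> bool" where
  "rook M \<longleftrightarrow> same_piece M {(1, 0), (0, 1)}"

definition semirook :: "move set \<Rightarrow> bool" where
  "semirook M \<longleftrightarrow> same_piece M {(1, 0)} \<or> same_piece M {(0, 1)}"

definition semibishop :: "move set \<Rightarrow> bool" where
  "semibishop M \<longleftrightarrow> same_piece M {(1, 1)} \<or> same_piece M {(1, -1)}"

definition anassa :: "move set \<Rightarrow> bool" where
  "anassa M \<longleftrightarrow> (\<exists>a\<in>{(1, 0), (0, 1)}. \<exists>b\<in>{(1, 1), (1, -1)}. same_piece M {a, b})"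

definition attacks :: "move set \<Rightarrow> int \<times> int \<Rightarrow> int \<times> int \<Rightarrow> bool" where
  "attacks M z z' \<longleftrightarrow> (\<exists>(c, d)\<in>M. \<exists>k::int. z' - z = (k * c, k * d))"

definition board :: "nat \<Rightarrow> (int \<times> int) set" where
  "board n = {1..int n} \<times> {1..int n}"

text \<open>
  Two pieces on the same square attack each other (take the multiple 0 of any move), so a
  nonattacking placement of \<open>q\<close> unlabelled pieces is a set of \<open>q\<close> squares.
\<close>
definition placement_count :: "move set \<Rightarrow> nat \<Rightarrow> nat \<Rightarrow> nat" where
  "placement_count M q n =
     card {S. S \<subseteq> board n \<and> card S = q \<and> (\<forall>z\<in>S. \<forall>z'\<in>S. z \<noteq> z' \<longrightarrow> \<not> attacks M z z')}"

text \<open>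
  Points of \<open>(\<real>\<^sup>2)\<^sup>q\<close>: functions on \<open>{1..q}\<close>, fixed to be \<open>undefined\<close> elsewhere, so that two
  configurations are equal iff their coordinates are.
\<close>
definition configs :: "nat \<Rightarrow> (nat \<Rightarrow> real \<times> real) set" where
  "configs q = {1..q} \<rightarrow>\<^sub>E UNIV"

definition cube :: "nat \<Rightarrow> (nat \<Rightarrow> real \<times> real) set" where
  "cube q = {1..q} \<rightarrow>\<^sub>E {0..1} \<times> {0..1}"

definition move_hyperplane :: "nat \<Rightarrow> move \<Rightarrow> nat \<Rightarrow> nat \<Rightarrow> (nat \<Rightarrow> real \<times> real) set" where
  "move_hyperplane q m i j =
     {z \<in> configs q. (z j - z i) \<bullet> (real_of_int (snd m), - real_of_int (fst m)) = 0}"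

definition move_arrangement :: "move set \<Rightarrow> nat \<Rightarrow> (nat \<Rightarrow> real \<times> real) set set" where
  "move_arrangement M q = {move_hyperplane q m i j | m i j. m \<in> M \<and> 1 \<le> i \<and> i < j \<and> j \<le> q}"

definition facet_hyperplanes :: "nat \<Rightarrow> (nat \<Rightarrow> real \<times> real) set set" where
  "facet_hyperplanes q =
     {{z \<in> configs q. fst (z i) = e} | i e. i \<in> {1..q} \<and> e \<in> {0, 1}} \<union>
     {{z \<in> configs q. snd (z i) = e} | i e. i \<in> {1..q} \<and> e \<in> {0, 1}}"

text \<open>The intersection of the empty family of hyperplanes is the whole space \<open>configs q\<close>.\<close>
definition vertices :: "move set \<Rightarrow> nat \<Rightarrow> (nat \<Rightarrow> real \<times> real) set" where
  "vertices M q =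
     {z \<in> cube q. \<exists>\<H> \<subseteq> move_arrangement M q \<union> facet_hyperplanes q. configs q \<inter> \<Inter>\<H> = {z}}"

text \<open>
  Least common denominator of the coordinates.  Vertices have rational coordinates, so the
  \<open>LEAST\<close> is attained on them.
\<close>
definition point_denominator :: "nat \<Rightarrow> (nat \<Rightarrow> real \<times> real) \<Rightarrow> nat" where
  "point_denominator q z =
     (LEAST D. D > 0 \<and> (\<forall>i\<in>{1..q}. real D * fst (z i) \<in> \<int> \<and> real D * snd (z i) \<in> \<int>))"

text \<open>There are only finitely many hyperplanes, hence finitely many vertices.\<close>
definition denominator :: "move set \<Rightarrow> nat \<Rightarrow> nat" where
  "denominator M q = Lcm (point_denominator q ` vertices M q)"

end

theory Submission imports Defs begin

text \<open>
  For each of the four pieces there is a rounding map of the plane to the integer lattice, such as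
  \<open>(x, y) \<mapsto> (\<lfloor>y\<rfloor> + \<lceil>x - y\<rceil>, \<lfloor>y\<rfloor>)\<close>, that fixes coordinates 0 and 1 and preserves alignment along every
  move.  Applied to a vertex it gives another point on all its hyperplanes, hence the vertex itself,
  which is therefore integral.  Any other piece has a move of slope different from 0, 1, -1 and
  infinity, or both diagonals, or both rook moves and a diagonal; each of these produces a
  nonintegral vertex with at most four pieces.

  For the counting functions, the squares of the board are encoded by pairs in \<open>{..<n} \<times> {..<n}\<close> so that
  attacking depends only on the order relations between the four entries.  The number of
  nonattacking \<open>q\<close>-sets is then a combination of the binomial coefficients \<open>n choose j\<close> with
  \<open>j \<le> 2 * q\<close>, whose coefficients do not depend on \<open>n\<close>.
\<close>

section \<open>Moves up to sign\<close>

lemma move_hyperplane_uminus: "move_hyperplane q (- m) i j = move_hyperplane q m i j"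
  by (auto simp: move_hyperplane_def inner_prod_def)

text \<open>A move and its negative define the same hyperplane, so the arrangement depends only on
  the sign closure that \<open>same_piece\<close> compares.\<close>

lemma move_arrangement_sym: "move_arrangement (M \<union> uminus ` M) q = move_arrangement M q"
  unfolding move_arrangement_def
  by (rule set_eqI) (use move_hyperplane_uminus in blast)

lemma vertices_same_piece:
  assumes "same_piece M N"
  shows "vertices M q = vertices N q"
proof -
  have "move_arrangement M q = move_arrangement N q"
    using move_arrangement_sym[of M q] move_arrangement_sym[of N q]
      assms[unfolded same_piece_def] by (simp only:)
  then show ?thesis by (simp only: vertices_def)
qed

lemma denominator_same_piece: "same_piece M N \<Longrightarrow> denominator M q = denominator N q"
  unfolding denominator_def by (simp add: vertices_same_piece)

lemma attacks_iff: "attacks M z z' \<longleftrightarrow> (\<exists>m\<in>M. attacks {m} z z')"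
  by (auto simp: attacks_def)

lemma attacks_single: "attacks {m} z z' \<longleftrightarrow> (\<exists>k. z' - z = (k * fst m, k * snd m))"
  by (cases m) (simp add: attacks_def)

lemma attacks_uminus: "attacks {- m} z z' \<longleftrightarrow> attacks {m} z z'"
proof -
  have "attacks {m} z z'" if neg: "attacks {- m} z z'" for m
  proof -
    obtain k where "z' - z = (k * fst (- m), k * snd (- m))"
      using neg attacks_single by blast
    then have "z' - z = ((- k) * fst m, (- k) * snd m)" by simp
    then show ?thesis unfolding attacks_single by blast
  qed
  from this[of m] this[of "- m"] show ?thesis by auto
qed

lemma attacks_same_piece:
  assumes "same_piece M N"
  shows "attacks M = attacks N"
proof -
  have sym: "attacks (M \<union> uminus ` M) = attacks M" for M
  proof (intro ext)
    fix z z'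
    have "attacks (M \<union> uminus ` M) z z' \<longleftrightarrow>
        (\<exists>m\<in>M. attacks {m} z z') \<or> (\<exists>m\<in>M. attacks {- m} z z')"
      by (subst attacks_iff) (auto simp only: bex_Un bex_simps)
    then show "attacks (M \<union> uminus ` M) z z' = attacks M z z'"
      unfolding attacks_uminus using attacks_iff[of M] by simp
  qed
  show ?thesis
    using sym[of M] sym[of N] assms[unfolded same_piece_def] by (simp only:)
qed

lemma placement_count_same_piece:
  "same_piece M N \<Longrightarrow> placement_count M q n = placement_count N q n"
  unfolding placement_count_def by (simp add: attacks_same_piece)

section \<open>Integral vertices\<close>

text \<open>The three clauses match the three kinds of hyperplanes through a vertex: facets in x,
  facets in y, and move hyperplanes, the last as a vanishing cross product with
  \<open>(c, d)\<close>.\<close>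

definition rounding :: "(real \<times> real \<Rightarrow> int \<times> int) \<Rightarrow> move set \<Rightarrow> bool" where
  "rounding \<rho> M \<longleftrightarrow>
     (\<forall>p. fst p \<in> {0, 1} \<longrightarrow> of_int (fst (\<rho> p)) = fst p) \<and>
     (\<forall>p. snd p \<in> {0, 1} \<longrightarrow> of_int (snd (\<rho> p)) = snd p) \<and>
     (\<forall>(c, d)\<in>M. \<forall>p p'. (fst p' - fst p) * of_int d = (snd p' - snd p) * of_int c \<longrightarrow>
        (fst (\<rho> p') - fst (\<rho> p)) * d = (snd (\<rho> p') - snd (\<rho> p)) * c)"

definition roundable :: "move set \<Rightarrow> bool" where
  "roundable M \<longleftrightarrow> (\<exists>\<rho>. rounding \<rho> M)"

lemma roundable_subset: "roundable M \<Longrightarrow> N \<subseteq> M \<Longrightarrow> roundable N"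
  unfolding roundable_def rounding_def by (elim ex_forward conj_forward) blast+

text \<open>Rounding a vertex keeps it on all hyperplanes that determine it, so it does not move.\<close>
lemma roundable_denominator:
  assumes "roundable M"
  shows "denominator M q = 1"
proof -
  obtain \<rho> where \<rho>: "rounding \<rho> M" using assms unfolding roundable_def by blast
  have fx: "of_int (fst (\<rho> p)) = fst p" if "fst p \<in> {0, 1}" for p
    using \<rho> that unfolding rounding_def by blast
  have fy: "of_int (snd (\<rho> p)) = snd p" if "snd p \<in> {0, 1}" for p
    using \<rho> that unfolding rounding_def by blast
  have mv: "(fst (\<rho> p') - fst (\<rho> p)) * d = (snd (\<rho> p') - snd (\<rho> p)) * c"
    if "(c, d) \<in> M" "(fst p' - fst p) * of_int d = (snd p' - snd p) * of_int c" for c d p p'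
    using \<rho> that unfolding rounding_def by blast
  have "point_denominator q z = 1" if z: "z \<in> vertices M q" for z
  proof -
    obtain H where H: "H \<subseteq> move_arrangement M q \<union> facet_hyperplanes q"
      and Hz: "configs q \<inter> \<Inter>H = {z}"
      using z unfolding vertices_def by blast
    \<comment> \<open>Every piece is rounded by the same map, so alignments between different pieces
      survive.\<close>
    define w where "w = (\<lambda>i\<in>{1..q}. (real_of_int (fst (\<rho> (z i))), real_of_int (snd (\<rho> (z i)))))"
    have "w \<in> configs q" by (simp add: w_def configs_def)
    moreover have "w \<in> h" if h: "h \<in> H" for h
    proof -
      have zh: "z \<in> h" using Hz h by blast
      consider m i j where "h = move_hyperplane q m i j" "m \<in> M" "1 \<le> i" "i < j" "j \<le> q"
        | i e where "h = {z \<in> configs q. fst (z i) = e}" "i \<in> {1..q}" "e \<in> {0, 1}"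
        | i e where "h = {z \<in> configs q. snd (z i) = e}" "i \<in> {1..q}" "e \<in> {0, 1}"
        using H h unfolding move_arrangement_def facet_hyperplanes_def by blast
      then show ?thesis
      proof cases
        case 1
        obtain c d where m: "m = (c, d)" by fastforce
        have "(fst (\<rho> (z j)) - fst (\<rho> (z i))) * d = (snd (\<rho> (z j)) - snd (\<rho> (z i))) * c"
          using mv[of c d "z j" "z i"] zh 1 m
          by (simp add: move_hyperplane_def inner_prod_def)
        then have "real_of_int ((fst (\<rho> (z j)) - fst (\<rho> (z i))) * d)
            = real_of_int ((snd (\<rho> (z j)) - snd (\<rho> (z i))) * c)" by presburger
        then show ?thesis
          using \<open>w \<in> configs q\<close> 1 m by (simp add: move_hyperplane_def inner_prod_def w_def)
      next
        case 2
        then show ?thesis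
          using zh fx[of "z i"] \<open>w \<in> configs q\<close> by (auto simp: w_def)
      next
        case 3
        then show ?thesis
          using zh fy[of "z i"] \<open>w \<in> configs q\<close> by (auto simp: w_def)
      qed
    qed
    ultimately have "w = z" using Hz by blast
    then have "\<forall>i\<in>{1..q}. fst (z i) \<in> \<int> \<and> snd (z i) \<in> \<int>"
      by (metis (no_types, lifting) Ints_of_int fst_conv restrict_apply' snd_conv w_def)
    then show ?thesis
      unfolding point_denominator_def by (intro Least_equality) auto
  qed
  then show ?thesis
    unfolding denominator_def Lcm_1_iff by auto
qed

lemma roundable_rook: "roundable {(1, 0), (0, 1)}"
  unfolding roundable_def rounding_def
  by (rule exI[of _ "\<lambda>(x, y). (\<lfloor>x\<rfloor>, \<lfloor>y\<rfloor>)"]) auto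

text \<open>Each of the two moves preserves a linear form: y or x for the rook move, x - y or x + y
  for the diagonal one. Both forms are rounded and the remaining coordinate is recovered from them.
  The first map rounds x - y up because \<lceil>x - y\<rceil> = x - \<lfloor>y\<rfloor> for integral
  x, which fixes x = 0 and x = 1.\<close>

lemma roundable_anassa:
  assumes "a \<in> {(1, 0), (0, 1)}" "b \<in> {(1, 1), (1, -1)}"
  shows "roundable {a, b}"
proof -
  have diff: "\<lfloor>x' - y'\<rfloor> = \<lfloor>x - y\<rfloor>" if "y + x' = x + y'" for x y x' y' :: real
    using that by (intro arg_cong[where f = floor]) linarith
  have 1: "roundable {(1, 0), (1, 1)}"
    unfolding roundable_def rounding_def
    by (rule exI[of _ "\<lambda>(x, y). (\<lfloor>y\<rfloor> + \<lceil>x - y\<rceil>, \<lfloor>y\<rfloor>)"])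
      (auto simp: ceiling_def algebra_simps intro: diff)
  have 2: "roundable {(1, 0), (1, -1)}"
    unfolding roundable_def rounding_def
    by (rule exI[of _ "\<lambda>(x, y). (\<lfloor>x + y\<rfloor> - \<lfloor>y\<rfloor>, \<lfloor>y\<rfloor>)"])
      (auto simp: algebra_simps)
  have 3: "roundable {(0, 1), (1, 1)}"
    unfolding roundable_def rounding_def
    by (rule exI[of _ "\<lambda>(x, y). (\<lfloor>x\<rfloor>, \<lfloor>x\<rfloor> - \<lfloor>x - y\<rfloor>)"])
      (auto simp: algebra_simps intro: diff)
  have 4: "roundable {(0, 1), (1, -1)}"
    unfolding roundable_def rounding_def
    by (rule exI[of _ "\<lambda>(x, y). (\<lfloor>x\<rfloor>, \<lfloor>x + y\<rfloor> - \<lfloor>x\<rfloor>)"])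
      (auto simp: algebra_simps)
  show ?thesis using assms 1 2 3 4 by auto
qed

section \<open>Polynomial counting functions\<close>

text \<open>Both entries of both pairs are relabelled by one increasing map, so \<open>R\<close> may
  also compare first entries with second ones. Initial segments suffice as domains: every finite set
  of naturals is an increasing image of one.\<close>

definition order_invariant :: "(nat \<times> nat \<Rightarrow> nat \<times> nat \<Rightarrow> bool) \<Rightarrow> bool" where
  "order_invariant R \<longleftrightarrow> (\<forall>j g. strict_mono_on {..<j} g \<longrightarrow>
     (\<forall>p\<in>{..<j} \<times> {..<j}. \<forall>p'\<in>{..<j} \<times> {..<j}. R (map_prod g g p) (map_prod g g p') = R p p'))"

definition independent_sets :: "('a \<Rightarrow> 'a \<Rightarrow> bool) \<Rightarrow> 'a set \<Rightarrow> nat \<Rightarrow> 'a set set" where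
  "independent_sets R A q =
     {S. S \<subseteq> A \<and> card S = q \<and> (\<forall>z\<in>S. \<forall>z'\<in>S. z \<noteq> z' \<longrightarrow> \<not> R z z')}"

lemma bij_betw_independent_sets:
  assumes f: "bij_betw f A B" and R: "\<And>z z'. z \<in> A \<Longrightarrow> z' \<in> A \<Longrightarrow> R z z' \<longleftrightarrow> R' (f z) (f z')"
  shows "bij_betw ((`) f) (independent_sets R A q) (independent_sets R' B q)"
proof (rule bij_betw_imageI)
  have inj: "inj_on f A" and im: "f ` A = B" using f by (auto simp: bij_betw_def)
  show "inj_on ((`) f) (independent_sets R A q)"
    by (rule inj_onI) (metis (no_types, lifting) independent_sets_def inj inj_on_image_eq_iff mem_Collect_eq)
  have "f ` S \<in> independent_sets R' B q \<longleftrightarrow> S \<in> independent_sets R A q" if "S \<subseteq> A" for S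
  proof -
    have "card (f ` S) = card S" using card_image inj inj_on_subset that by blast
    moreover have "(\<forall>z\<in>f ` S. \<forall>z'\<in>f ` S. z \<noteq> z' \<longrightarrow> \<not> R' z z') \<longleftrightarrow>
        (\<forall>z\<in>S. \<forall>z'\<in>S. z \<noteq> z' \<longrightarrow> \<not> R z z')"
    proof -
      have "f z = f z' \<longleftrightarrow> z = z'" "R z z' \<longleftrightarrow> R' (f z) (f z')" if "z \<in> S" "z' \<in> S" for z z'
        using R[of z z'] inj_on_eq_iff[OF inj, of z z'] that \<open>S \<subseteq> A\<close> by blast+
      then show ?thesis by simp
    qed
    ultimately show ?thesis using that im unfolding independent_sets_def by auto
  qed
  moreover have "S \<in> independent_sets R' B q \<Longrightarrow> \<exists>S0\<subseteq>A. S = f ` S0" for S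
    using im unfolding independent_sets_def by (auto simp: subset_image_iff)
  moreover have "S \<in> independent_sets R A q \<Longrightarrow> S \<subseteq> A" for S
    by (simp add: independent_sets_def)
  ultimately show "(`) f ` independent_sets R A q = independent_sets R' B q"
    by (auto simp: image_iff) (metis image_iff)+
qed

text \<open>A set with coordinates in \<open>{..<n}\<close> is a choice of the set of coordinates that occur, together with
  the order type of the set.\<close>
lemma card_independent_sets_order_invariant:
  assumes R: "order_invariant R" and q: "q \<ge> 1"
  shows "card (independent_sets R ({..<n} \<times> {..<n}) q) =
    (\<Sum>j\<le>2 * q. card {S \<in> independent_sets R ({..<j} \<times> {..<j}) q. fst ` S \<union> snd ` S = {..<j}} * (n choose j))"
proof -
  define coords :: "(nat \<times> nat) set \<Rightarrow> nat set" where "coords S = fst ` S \<union> snd ` S" for S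
  define T where "T n = independent_sets R ({..<n} \<times> {..<n}) q" for n
  \<comment> \<open>\<open>E j\<close> collects the order types with exactly j distinct entries:
    every element of \<open>{..<j}\<close> has to occur.\<close>
  define E where "E j = {S \<in> T j. coords S = {..<j}}" for j
  have finT: "finite (T n)" for n
    by (rule finite_subset[of _ "Pow ({..<n} \<times> {..<n})"]) (auto simp: T_def independent_sets_def)
  have fibre: "card {S \<in> T n. coords S = V} = card (E (card V))" if V: "V \<subseteq> {..<n}" for V
  proof -
    have "finite V" using V finite_subset by blast
    \<comment> \<open>The increasing enumeration of V turns order types on \<open>card V\<close>
      entries into the sets with entry set V.\<close>
    then obtain g where g: "bij_betw g {..<card V} V" "strict_mono_on {..<card V} g"
      using ex_bij_betw_strict_mono_card by blast
    let ?f = "map_prod g g"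
    let ?I = "\<lambda>U. independent_sets R (U \<times> U) q"
    have f: "bij_betw ?f ({..<card V} \<times> {..<card V}) (V \<times> V)"
      using g(1) by (auto simp: bij_betw_def map_prod_inj_on map_prod_surj_on)
    have bij: "bij_betw ((`) ?f) (?I {..<card V}) (?I V)"
      by (rule bij_betw_independent_sets[OF f]) (use R g(2) in \<open>auto simp: order_invariant_def\<close>)
    have c: "coords (?f ` S) = g ` coords S" for S
      by (force simp: coords_def image_iff)
    have "coords (?f ` S) = V \<longleftrightarrow> coords S = {..<card V}" if "S \<in> ?I {..<card V}" for S
    proof -
      have "coords S \<subseteq> {..<card V}"
        using that by (auto simp: coords_def independent_sets_def)
      then show ?thesis unfolding c using g(1)
        by (metis bij_betw_def inj_on_image_eq_iff order_refl)
    qed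
    then have "bij_betw ((`) ?f) {S \<in> ?I {..<card V}. coords S = {..<card V}} {S \<in> ?I V. coords S = V}"
      by (intro bij_betw_Collect[OF bij]) auto
    then have "card (E (card V)) = card {S \<in> ?I V. coords S = V}"
      unfolding E_def T_def using bij_betw_same_card by blast
    moreover have "{S \<in> ?I V. coords S = V} = {S \<in> T n. coords S = V}"
    proof -
      have "S \<subseteq> coords S \<times> coords S" for S by (force simp: coords_def)
      then show ?thesis unfolding T_def independent_sets_def using V by fastforce
    qed
    ultimately show ?thesis by simp
  qed
  \<comment> \<open>q pairs have at most 2q entries, which bounds the sum independently of
    n.\<close>
  have E0: "E j = {}" if "j > 2 * q" for j
  proof -
    have "card (coords S) \<le> 2 * q" if "S \<in> T j" for S
    proof -
      have "card S = q" using that by (simp add: T_def independent_sets_def)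
      then have "finite S" using q card_ge_0_finite[of S] by auto
      then have "card (fst ` S) \<le> q" "card (snd ` S) \<le> q"
        using card_image_le \<open>card S = q\<close> by blast+
      then show ?thesis unfolding coords_def using card_Un_le[of "fst ` S" "snd ` S"] by linarith
    qed
    then show ?thesis using that unfolding E_def by fastforce
  qed
  have coordsn: "coords S \<in> Pow {..<n}" if "S \<in> T n" for S
    using that by (auto simp: T_def coords_def independent_sets_def)
  have "card (T n) = (\<Sum>V\<in>Pow {..<n}. \<Sum>S\<in>{S \<in> T n. coords S = V}. 1)"
    using sum.group[OF finT[of n], of "Pow {..<n}" coords "\<lambda>_. 1 :: nat"] coordsn
    by (simp add: image_subset_iff)
  also have "\<dots> = (\<Sum>V\<in>Pow {..<n}. card (E (card V)))"
    using fibre by (intro sum.cong) auto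
  also have "\<dots> = (\<Sum>j\<le>n. \<Sum>V\<in>{V \<in> Pow {..<n}. card V = j}. card (E (card V)))"
    by (rule sum.group[symmetric])
      (auto intro!: card_mono[of "{..<n}", simplified])
  also have "\<dots> = (\<Sum>j\<le>n. card (E j) * (n choose j))"
    using n_subsets[of "{..<n}"] by (intro sum.cong) auto
  \<comment> \<open>The bound n is exchanged for 2q through their maximum: \<open>n choose j\<close>
    vanishes for j > n, and \<open>E j\<close> is empty for j > 2q.\<close>
  also have "\<dots> = (\<Sum>j\<le>max n (2 * q). card (E j) * (n choose j))"
    by (rule sum.mono_neutral_left) auto
  also have "\<dots> = (\<Sum>j\<le>2 * q. card (E j) * (n choose j))"
    by (rule sum.mono_neutral_right) (auto simp: E0)
  finally show ?thesis unfolding T_def E_def coords_def .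
qed

definition binomial_poly :: "nat \<Rightarrow> rat poly" where
  "binomial_poly k = smult (inverse (fact k)) (\<Prod>i<k. [:- of_nat i, 1:])"

lemma poly_binomial_poly: "poly (binomial_poly k) (of_nat n) = of_nat (n choose k)"
  by (simp add: binomial_poly_def binomial_gbinomial gbinomial_prod_rev poly_prod
      atLeast0LessThan divide_inverse mult.commute)

lemma polynomial_independent_sets:
  assumes "order_invariant R" "q \<ge> 1"
  shows "\<exists>p :: rat poly. \<forall>n. of_nat (card (independent_sets R ({..<n} \<times> {..<n}) q)) = poly p (of_nat n)"
  unfolding card_independent_sets_order_invariant[OF assms]
  by (rule exI[of _ "\<Sum>j\<le>2 * q. smult (of_nat (card {S \<in> independent_sets R ({..<j} \<times> {..<j}) q.
      fst ` S \<union> snd ` S = {..<j}})) (binomial_poly j)"])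
    (simp add: poly_sum poly_binomial_poly)

section \<open>Encodings of the board by order relations\<close>

text \<open>The relations are fixed before n and only the encoding varies with n; this makes the
  coefficients of the binomials independent of n. One relation per move lets a subset of the moves
  inherit the encoding.\<close>

definition order_encodable :: "move set \<Rightarrow> bool" where
  "order_encodable M \<longleftrightarrow> (\<exists>R. (\<forall>m\<in>M. order_invariant (R m)) \<and>
     (\<forall>n. \<exists>\<phi>. bij_betw \<phi> (board n) ({..<n} \<times> {..<n}) \<and>
        (\<forall>m\<in>M. \<forall>z\<in>board n. \<forall>z'\<in>board n. attacks {m} z z' \<longleftrightarrow> R m (\<phi> z) (\<phi> z'))))"

lemma order_encodable_subset: "order_encodable M \<Longrightarrow> N \<subseteq> M \<Longrightarrow> order_encodable N"
  unfolding order_encodable_def by (elim ex_forward conj_forward all_forward) blast+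

lemma order_encodable_polynomial:
  assumes "order_encodable M" "q \<ge> 1"
  shows "\<exists>p :: rat poly. \<forall>n. of_nat (placement_count M q n) = poly p (of_nat n)"
proof -
  obtain R where R: "\<And>m. m \<in> M \<Longrightarrow> order_invariant (R m)"
    and enc: "\<And>n. \<exists>\<phi>. bij_betw \<phi> (board n) ({..<n} \<times> {..<n}) \<and>
        (\<forall>m\<in>M. \<forall>z\<in>board n. \<forall>z'\<in>board n. attacks {m} z z' \<longleftrightarrow> R m (\<phi> z) (\<phi> z'))"
    using assms(1) unfolding order_encodable_def by blast
  define Q where "Q p p' \<longleftrightarrow> (\<exists>m\<in>M. R m p p')" for p p'
  \<comment> \<open>A disjunction of order-invariant relations is order-invariant.\<close>
  have "order_invariant Q"
    using R unfolding order_invariant_def Q_def by blast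
  moreover have "placement_count M q n = card (independent_sets Q ({..<n} \<times> {..<n}) q)" for n
  proof -
    obtain \<phi> where \<phi>: "bij_betw \<phi> (board n) ({..<n} \<times> {..<n})"
      and att: "\<forall>m\<in>M. \<forall>z\<in>board n. \<forall>z'\<in>board n. attacks {m} z z' \<longleftrightarrow> R m (\<phi> z) (\<phi> z')"
      using enc by blast
    have "attacks M z z' \<longleftrightarrow> Q (\<phi> z) (\<phi> z')" if "z \<in> board n" "z' \<in> board n" for z z'
      using att that attacks_iff[of M z z'] by (auto simp: Q_def)
    from bij_betw_independent_sets[where R = "attacks M" and R' = Q, OF \<phi> this] show ?thesis
      unfolding placement_count_def independent_sets_def using bij_betw_same_card by blast
  qed
  ultimately show ?thesis using polynomial_independent_sets assms(2) by simp
qed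

text \<open>A component equal to 1 lets the multiplier be read off, so here and in the next three
  lemmas attacking means agreeing in one linear form.\<close>

lemma attacks_horizontal: "attacks {(1, 0)} (x, y) (x', y') \<longleftrightarrow> y = y'"
  by (auto simp: attacks_def)

lemma attacks_vertical: "attacks {(0, 1)} (x, y) (x', y') \<longleftrightarrow> x = x'"
  by (auto simp: attacks_def)

lemma attacks_diagonal: "attacks {(1, 1)} (x, y) (x', y') \<longleftrightarrow> x - y = x' - y'"
  by (auto simp: attacks_def)

lemma attacks_antidiagonal: "attacks {(1, -1)} (x, y) (x', y') \<longleftrightarrow> x + y = x' + y'"
  by (auto simp: attacks_def)

lemma order_invariant_fst: "order_invariant (\<lambda>p p'. fst p = fst p')"
  by (auto simp: order_invariant_def strict_mono_on_eq)

lemma order_invariant_snd: "order_invariant (\<lambda>p p'. snd p = snd p')"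
  by (auto simp: order_invariant_def strict_mono_on_eq)

lemma order_encodable_rook: "order_encodable {(1, 0), (0, 1)}"
proof -
  let ?R = "\<lambda>m :: move. if m = (1, 0) then (\<lambda>p p' :: nat \<times> nat. snd p = snd p') else (\<lambda>p p'. fst p = fst p')"
  let ?\<phi> = "\<lambda>(x :: int, y :: int). (nat (x - 1), nat (y - 1))"
  have "bij_betw ?\<phi> (board n) ({..<n} \<times> {..<n})" for n
    by (rule bij_betw_byWitness[where f' = "\<lambda>(r, t). (int r + 1, int t + 1)"]) (auto simp: board_def)
  then show ?thesis
    unfolding order_encodable_def
    by (intro exI[of _ ?R] conjI allI)
      (auto simp: order_invariant_fst order_invariant_snd attacks_horizontal attacks_vertical board_def
        intro!: exI[of _ ?\<phi>])
qed

definition same_diagonal :: "nat \<times> nat \<Rightarrow> nat \<times> nat \<Rightarrow> bool" where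
  "same_diagonal p p' \<longleftrightarrow> snd p = snd p' \<and> (fst p \<le> snd p \<longleftrightarrow> fst p' \<le> snd p')"

lemma order_invariant_same_diagonal: "order_invariant same_diagonal"
  by (auto simp: order_invariant_def same_diagonal_def strict_mono_on_eq strict_mono_on_less_eq)

text \<open>Encodes a square of the board by its row and by \<open>y - x - 1\<close> modulo \<open>n\<close>: the two diagonals in a
  residue class are told apart by comparing both entries.\<close>
definition diagonal_code :: "nat \<Rightarrow> int \<times> int \<Rightarrow> nat \<times> nat" where
  "diagonal_code n = (\<lambda>(x, y). (nat (y - 1), nat (if x < y then y - x - 1 else y - x - 1 + int n)))"

lemma bij_betw_diagonal_code: "bij_betw (diagonal_code n) (board n) ({..<n} \<times> {..<n})"
  \<comment> \<open>The inverse recovers x as the representative of r - t modulo n in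
    \<open>{1..n}\<close>.\<close>
  by (rule bij_betw_byWitness[where f' = "\<lambda>(r, t). (if r \<le> t then int r - int t + int n else int r - int t, int r + 1)"])
    (auto simp: board_def diagonal_code_def split: if_splits)

text \<open>The first entry of a code is at most the second exactly when x \<ge> y. Within either
  case the second entry determines y - x, and squares from different cases lie on different
  diagonals.\<close>

lemma same_diagonal_code:
  assumes "(x, y) \<in> board n" "(x', y') \<in> board n"
  shows "same_diagonal (diagonal_code n (x, y)) (diagonal_code n (x', y')) \<longleftrightarrow> x - y = x' - y'"
  using assms by (auto simp: board_def same_diagonal_def diagonal_code_def)

text \<open>The board symmetry \<open>s\<close> carries the pair of moves \<open>a\<close>, \<open>b\<close> to \<open>(1, 0)\<close>, \<open>(1, 1)\<close>.\<close>
lemma order_encodable_symmetry: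
  assumes s: "\<And>n. bij_betw (s n) (board n) (board n)"
    and a: "\<And>n z z'. z \<in> board n \<Longrightarrow> z' \<in> board n \<Longrightarrow> attacks {a} z z' \<longleftrightarrow> snd (s n z) = snd (s n z')"
    and b: "\<And>n z z'. z \<in> board n \<Longrightarrow> z' \<in> board n \<Longrightarrow>
      attacks {b} z z' \<longleftrightarrow> fst (s n z) - snd (s n z) = fst (s n z') - snd (s n z')"
    and ab: "a \<noteq> b"
  shows "order_encodable {a, b}"
proof -
  let ?R = "\<lambda>m. if m = a then (\<lambda>p p'. fst p = fst p') else same_diagonal"
  have "\<exists>\<phi>. bij_betw \<phi> (board n) ({..<n} \<times> {..<n}) \<and>
        (\<forall>m\<in>{a, b}. \<forall>z\<in>board n. \<forall>z'\<in>board n. attacks {m} z z' \<longleftrightarrow> ?R m (\<phi> z) (\<phi> z'))" for n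
  proof (intro exI[of _ "diagonal_code n \<circ> s n"] conjI ballI)
    show "bij_betw (diagonal_code n \<circ> s n) (board n) ({..<n} \<times> {..<n})"
      using bij_betw_trans[OF s bij_betw_diagonal_code] .
    fix m z z' assume m: "m \<in> {a, b}" and z: "z \<in> board n" "z' \<in> board n"
    have sz: "s n z \<in> board n" "s n z' \<in> board n" using z s by (auto dest: bij_betwE)
    have "fst (diagonal_code n (s n z)) = fst (diagonal_code n (s n z')) \<longleftrightarrow> snd (s n z) = snd (s n z')"
      using sz by (auto simp: diagonal_code_def board_def)
    moreover have "same_diagonal (diagonal_code n (s n z)) (diagonal_code n (s n z')) \<longleftrightarrow>
        fst (s n z) - snd (s n z) = fst (s n z') - snd (s n z')"
      using same_diagonal_code[of "fst (s n z)" "snd (s n z)" n "fst (s n z')" "snd (s n z')"] sz by simp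
    ultimately show "attacks {m} z z' \<longleftrightarrow> ?R m ((diagonal_code n \<circ> s n) z) ((diagonal_code n \<circ> s n) z')"
      using m a[OF z] b[OF z] ab by auto
  qed
  then show ?thesis
    unfolding order_encodable_def
    by (intro exI[of _ ?R]) (auto simp: order_invariant_fst order_invariant_same_diagonal)
qed

text \<open>The four symmetries are the identity, the left-right reflection, the transposition and a
  quarter turn; \<open>n + 1 - x\<close> reflects a coordinate within \<open>{1..n}\<close>.\<close>

lemma order_encodable_anassa:
  assumes "a \<in> {(1, 0), (0, 1)}" "b \<in> {(1, 1), (1, -1)}"
  shows "order_encodable {a, b}"
proof -
  note att = attacks_horizontal attacks_vertical attacks_diagonal attacks_antidiagonal
  have bij: "bij_betw s (board n) (board n)" if "\<And>z. z \<in> board n \<Longrightarrow> s z \<in> board n \<and> s' (s z) = z"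
    "\<And>z. z \<in> board n \<Longrightarrow> s' z \<in> board n \<and> s (s' z) = z" for s s' n
    using that by (intro bij_betw_byWitness[where f' = s']) auto
  have 1: "order_encodable {(1, 0), (1, 1)}"
    by (rule order_encodable_symmetry[where s = "\<lambda>n. id"]) (auto simp: att)
  have 2: "order_encodable {(1, 0), (1, -1)}"
    by (rule order_encodable_symmetry[where s = "\<lambda>n (x, y). (int n + 1 - x, y)"],
        rule bij[where s' = "\<lambda>(x, y). (int _ + 1 - x, y)"]) (auto simp: att board_def)
  have 3: "order_encodable {(0, 1), (1, 1)}"
    by (rule order_encodable_symmetry[where s = "\<lambda>n (x, y). (y, x)"],
        rule bij[where s' = "\<lambda>(x, y). (y, x)"]) (auto simp: att board_def)
  have 4: "order_encodable {(0, 1), (1, -1)}"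
    by (rule order_encodable_symmetry[where s = "\<lambda>n (x, y). (int n + 1 - y, x)"],
        rule bij[where s' = "\<lambda>(x, y). (y, int _ + 1 - x)"]) (auto simp: att board_def)
  show ?thesis using assms 1 2 3 4 by auto
qed

section \<open>Nonintegral vertices\<close>

text \<open>The common denominator \<open>D\<close> ensures that the \<open>LEAST\<close> is
  attained. A nonintegral coordinate keeps the least one from being 1, and it divides the
  \<open>Lcm\<close>.\<close>

lemma denominator_ne_1:
  assumes "z \<in> vertices M q" and D: "D > 0"
    and int: "\<forall>i\<in>{1..q}. real D * fst (z i) \<in> \<int> \<and> real D * snd (z i) \<in> \<int>"
    and k: "k \<in> {1..q}" "fst (z k) \<notin> \<int> \<or> snd (z k) \<notin> \<int>"
  shows "denominator M q \<noteq> 1"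
proof
  assume "denominator M q = 1"
  then have "point_denominator q z = 1"
    using assms(1) unfolding denominator_def by (metis dvd_Lcm imageI nat_dvd_1_iff_1)
  moreover have "\<forall>i\<in>{1..q}. real (point_denominator q z) * fst (z i) \<in> \<int> \<and>
      real (point_denominator q z) * snd (z i) \<in> \<int>"
    unfolding point_denominator_def by (rule LeastI2[of _ D]) (use D int in auto)
  ultimately show False using k by auto
qed

text \<open>All hyperplanes through \<open>z\<close> are used to determine \<open>z\<close>.\<close>
lemma verticesI:
  assumes cube: "z \<in> cube q"
    and unique: "\<And>w. (\<And>i. i \<in> {1..q} \<Longrightarrow> fst (z i) \<in> {0, 1} \<Longrightarrow> fst (w i) = fst (z i)) \<Longrightarrow>
      (\<And>i. i \<in> {1..q} \<Longrightarrow> snd (z i) \<in> {0, 1} \<Longrightarrow> snd (w i) = snd (z i)) \<Longrightarrow>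
      (\<And>c d i j. (c, d) \<in> M \<union> uminus ` M \<Longrightarrow> 1 \<le> i \<Longrightarrow> i < j \<Longrightarrow> j \<le> q \<Longrightarrow>
        (fst (z j) - fst (z i)) * of_int d = (snd (z j) - snd (z i)) * of_int c \<Longrightarrow>
        (fst (w j) - fst (w i)) * of_int d = (snd (w j) - snd (w i)) * of_int c) \<Longrightarrow>
      \<forall>i\<in>{1..q}. w i = z i"
  shows "z \<in> vertices M q"
proof -
  \<comment> \<open>Closing under sign leaves the arrangement unchanged and allows either sign of a
    move to be used later.\<close>
  define H where "H = {h \<in> move_arrangement (M \<union> uminus ` M) q \<union> facet_hyperplanes q. z \<in> h}"
  have z: "z \<in> configs q" using cube by (auto simp: cube_def configs_def PiE_def)
  have "w = z" if w: "w \<in> configs q" and wH: "\<And>h. h \<in> H \<Longrightarrow> w \<in> h" for w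
  proof -
    have "\<forall>i\<in>{1..q}. w i = z i"
    proof (rule unique)
      fix i assume i: "i \<in> {1..q}" 
      show "fst (w i) = fst (z i)" if "fst (z i) \<in> {0, 1}"
      proof -
        have "{w \<in> configs q. fst (w i) = fst (z i)} \<in> H"
          using z i that unfolding H_def facet_hyperplanes_def by blast
        then show ?thesis using wH by blast
      qed
      show "snd (w i) = snd (z i)" if "snd (z i) \<in> {0, 1}"
      proof -
        have "{w \<in> configs q. snd (w i) = snd (z i)} \<in> H"
          using z i that unfolding H_def facet_hyperplanes_def by blast
        then show ?thesis using wH by blast
      qed
    next
      fix c d i j
      assume m: "(c, d) \<in> M \<union> uminus ` M" and ij: "1 \<le> i" "i < j" "j \<le> q"
        and eq: "(fst (z j) - fst (z i)) * of_int d = (snd (z j) - snd (z i)) * of_int c"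
      have "z \<in> move_hyperplane q (c, d) i j"
        using z eq by (simp add: move_hyperplane_def inner_prod_def)
      then have "move_hyperplane q (c, d) i j \<in> H"
        using m ij unfolding H_def move_arrangement_def by blast
      then have "w \<in> move_hyperplane q (c, d) i j" by (rule wH)
      then show "(fst (w j) - fst (w i)) * of_int d = (snd (w j) - snd (w i)) * of_int c"
        by (simp add: move_hyperplane_def inner_prod_def)
    qed
    then show ?thesis
      using w z PiE_ext[of w "{1..q}" "\<lambda>_. UNIV" z] by (simp add: configs_def)
  qed
  then have "configs q \<inter> \<Inter>H = {z}" using z unfolding H_def by blast
  moreover have "H \<subseteq> move_arrangement M q \<union> facet_hyperplanes q"
    unfolding H_def move_arrangement_sym by blast
  ultimately show ?thesis
    using cube unfolding vertices_def by blast
qed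

section \<open>Explicit vertices with two, three and four pieces\<close>

lemma of_int_div_not_Ints:
  assumes "a \<noteq> 0" "\<bar>a\<bar> < \<bar>b\<bar>"
  shows "real_of_int k + real_of_int a / real_of_int b \<notin> \<int>"
proof
  let ?r = "real_of_int a / real_of_int b"
  assume "real_of_int k + ?r \<in> \<int>"
  then have "?r \<in> \<int>" by (metis Ints_diff Ints_of_int add_diff_cancel_left')
  then obtain l where l: "?r = real_of_int l" by (auto elim: Ints_cases)
  have "\<bar>?r\<bar> < 1" "?r \<noteq> 0" using assms by (auto simp: divide_less_eq)
  then have "\<bar>l\<bar> < 1" "l \<noteq> 0" unfolding l by (simp_all flip: of_int_abs)
  then show False by linarith
qed

lemma abs_mult_div_Ints: "real (nat \<bar>b\<bar>) * (real_of_int k + real_of_int a / real_of_int b) \<in> \<int>"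
proof (cases "b = 0")
  case False
  have "real (nat \<bar>b\<bar>) * (real_of_int k + real_of_int a / real_of_int b) = of_int (\<bar>b\<bar> * k + sgn b * a)"
    using False by (auto simp: abs_if sgn_if field_simps)
  then show ?thesis by (metis Ints_of_int)
qed auto

text \<open>A steep move leads from a corner to a nonintegral point of the opposite edge.\<close>
lemma denominator_steep_move:
  assumes m: "(c, d) \<in> M \<union> uminus ` M" and cd: "c \<noteq> 0" "\<bar>c\<bar> < \<bar>d\<bar>"
  shows "denominator M 2 \<noteq> 1"
proof -
  define r where "r = real_of_int c / real_of_int d"
  \<comment> \<open>r is the horizontal shift along the move from bottom to top; starting at the
    left corner for r > 0 and at the right one otherwise keeps k + r in [0, 1].\<close>
  define k :: int where "k = (if r > 0 then 0 else 1)"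
  define z :: "nat \<Rightarrow> real \<times> real" where
    "z = (\<lambda>i\<in>{1..2}. if i = 1 then (of_int k, 0) else (of_int k + r, 1))"
  have d: "d \<noteq> 0" using cd by auto
  have r: "\<bar>r\<bar> < 1" using cd d by (auto simp: r_def divide_less_eq)
  have z12: "z 1 = (of_int k, 0)" "z 2 = (of_int k + r, 1)" by (simp_all add: z_def)
  have "z \<in> vertices M 2"
  proof (rule verticesI)
    show "z \<in> cube 2" using r by (auto simp: cube_def z_def k_def)
    note One_nat_def [simp del]
    fix w :: "nat \<Rightarrow> real \<times> real"
    assume X: "\<And>i. i \<in> {1..2} \<Longrightarrow> fst (z i) \<in> {0, 1} \<Longrightarrow> fst (w i) = fst (z i)"
      and Y: "\<And>i. i \<in> {1..2} \<Longrightarrow> snd (z i) \<in> {0, 1} \<Longrightarrow> snd (w i) = snd (z i)"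
      and L: "\<And>c d i j. (c, d) \<in> M \<union> uminus ` M \<Longrightarrow> 1 \<le> i \<Longrightarrow> i < j \<Longrightarrow> j \<le> 2 \<Longrightarrow>
        (fst (z j) - fst (z i)) * of_int d = (snd (z j) - snd (z i)) * of_int c \<Longrightarrow>
        (fst (w j) - fst (w i)) * of_int d = (snd (w j) - snd (w i)) * of_int c"
    \<comment> \<open>Facets fix three of the four coordinates; the move hyperplane then determines
      the last.\<close>
    have w: "fst (w 1) = of_int k" "snd (w 1) = 0" "snd (w 2) = 1"
      using X[of 1] Y[of 1] Y[of 2] by (auto simp: z12 k_def)
    have "(fst (w 2) - fst (w 1)) * of_int d = (snd (w 2) - snd (w 1)) * of_int c"
      by (rule L[OF m]) (use d in \<open>auto simp: z12 r_def\<close>)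
    then have "fst (w 2) = of_int k + r"
      using d by (simp add: w r_def field_simps)
    then have "w 1 = z 1" "w 2 = z 2" by (simp_all add: z12 w prod_eq_iff)
    moreover have "i = 1 \<or> i = 2" if "i \<in> {1..2}" for i :: nat using that by auto
    ultimately show "\<forall>i\<in>{1..2}. w i = z i" by metis
  qed
  then show ?thesis
  proof (rule denominator_ne_1[where D = "nat \<bar>d\<bar>" and k = 2])
    show "\<forall>i\<in>{1..2}. real (nat \<bar>d\<bar>) * fst (z i) \<in> \<int> \<and> real (nat \<bar>d\<bar>) * snd (z i) \<in> \<int>"
      using abs_mult_div_Ints[of d k c] by (auto simp: z_def r_def)
    show "fst (z 2) \<notin> \<int> \<or> snd (z 2) \<notin> \<int>"
      using of_int_div_not_Ints[OF cd] by (simp add: z12 r_def)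
  qed (use d in auto)
qed

text \<open>The steep case with x and y exchanged: the move runs from a corner on the left edge to
  the right edge.\<close>

lemma denominator_flat_move:
  assumes m: "(c, d) \<in> M \<union> uminus ` M" and cd: "d \<noteq> 0" "\<bar>d\<bar> < \<bar>c\<bar>"
  shows "denominator M 2 \<noteq> 1"
proof -
  define r where "r = real_of_int d / real_of_int c"
  define k :: int where "k = (if r > 0 then 0 else 1)"
  define z :: "nat \<Rightarrow> real \<times> real" where
    "z = (\<lambda>i\<in>{1..2}. if i = 1 then (0, of_int k) else (1, of_int k + r))"
  have c: "c \<noteq> 0" using cd by auto
  have r: "\<bar>r\<bar> < 1" using cd c by (auto simp: r_def divide_less_eq)
  have z12: "z 1 = (0, of_int k)" "z 2 = (1, of_int k + r)" by (simp_all add: z_def)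
  have "z \<in> vertices M 2"
  proof (rule verticesI)
    show "z \<in> cube 2" using r by (auto simp: cube_def z_def k_def)
    note One_nat_def [simp del]
    fix w :: "nat \<Rightarrow> real \<times> real"
    assume X: "\<And>i. i \<in> {1..2} \<Longrightarrow> fst (z i) \<in> {0, 1} \<Longrightarrow> fst (w i) = fst (z i)"
      and Y: "\<And>i. i \<in> {1..2} \<Longrightarrow> snd (z i) \<in> {0, 1} \<Longrightarrow> snd (w i) = snd (z i)"
      and L: "\<And>c d i j. (c, d) \<in> M \<union> uminus ` M \<Longrightarrow> 1 \<le> i \<Longrightarrow> i < j \<Longrightarrow> j \<le> 2 \<Longrightarrow>
        (fst (z j) - fst (z i)) * of_int d = (snd (z j) - snd (z i)) * of_int c \<Longrightarrow>
        (fst (w j) - fst (w i)) * of_int d = (snd (w j) - snd (w i)) * of_int c"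
    have w: "fst (w 1) = 0" "fst (w 2) = 1" "snd (w 1) = of_int k"
      using X[of 1] X[of 2] Y[of 1] by (auto simp: z12 k_def)
    have "(fst (w 2) - fst (w 1)) * of_int d = (snd (w 2) - snd (w 1)) * of_int c"
      by (rule L[OF m]) (use c in \<open>auto simp: z12 r_def\<close>)
    then have "snd (w 2) = of_int k + r"
      using c by (simp add: w r_def field_simps)
    then have "w 1 = z 1" "w 2 = z 2" by (simp_all add: z12 w prod_eq_iff)
    moreover have "i = 1 \<or> i = 2" if "i \<in> {1..2}" for i :: nat using that by auto
    ultimately show "\<forall>i\<in>{1..2}. w i = z i" by metis
  qed
  then show ?thesis
  proof (rule denominator_ne_1[where D = "nat \<bar>c\<bar>" and k = 2])
    show "\<forall>i\<in>{1..2}. real (nat \<bar>c\<bar>) * fst (z i) \<in> \<int> \<and> real (nat \<bar>c\<bar>) * snd (z i) \<in> \<int>"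
      using abs_mult_div_Ints[of c k d] by (auto simp: z_def r_def)
    show "fst (z 2) \<notin> \<int> \<or> snd (z 2) \<notin> \<int>"
      using of_int_div_not_Ints[OF cd] by (simp add: z12 r_def)
  qed (use c in auto)
qed

lemma half_not_Ints: "1 / 2 \<notin> (\<int> :: real set)"
  using of_int_div_not_Ints[of 1 2 0] by simp

text \<open>The diagonals through two adjacent corners meet in the centre of the board.\<close>
lemma denominator_both_diagonals:
  assumes m: "(1, 1) \<in> M \<union> uminus ` M" "(1, -1) \<in> M \<union> uminus ` M"
  shows "denominator M 3 \<noteq> 1"
proof -
  define z :: "nat \<Rightarrow> real \<times> real" where
    "z = (\<lambda>i\<in>{1..3}. if i = 1 then (0, 0) else if i = 2 then (1, 0) else (1 / 2, 1 / 2))"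
  have z: "z 1 = (0, 0)" "z 2 = (1, 0)" "z 3 = (1 / 2, 1 / 2)" by (simp_all add: z_def)
  have "z \<in> vertices M 3"
  proof (rule verticesI)
    show "z \<in> cube 3" by (auto simp: cube_def z_def)
    note One_nat_def [simp del]
    fix w :: "nat \<Rightarrow> real \<times> real"
    assume X: "\<And>i. i \<in> {1..3} \<Longrightarrow> fst (z i) \<in> {0, 1} \<Longrightarrow> fst (w i) = fst (z i)"
      and Y: "\<And>i. i \<in> {1..3} \<Longrightarrow> snd (z i) \<in> {0, 1} \<Longrightarrow> snd (w i) = snd (z i)"
      and L: "\<And>c d i j. (c, d) \<in> M \<union> uminus ` M \<Longrightarrow> 1 \<le> i \<Longrightarrow> i < j \<Longrightarrow> j \<le> 3 \<Longrightarrow>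
        (fst (z j) - fst (z i)) * of_int d = (snd (z j) - snd (z i)) * of_int c \<Longrightarrow>
        (fst (w j) - fst (w i)) * of_int d = (snd (w j) - snd (w i)) * of_int c"
    have w: "fst (w 1) = 0" "fst (w 2) = 1" "snd (w 1) = 0" "snd (w 2) = 0"
      using X[of 1] X[of 2] Y[of 1] Y[of 2] by (auto simp: z)
    have "fst (w 3) = snd (w 3)" "fst (w 3) - 1 = - snd (w 3)"
      using L[OF m(1), of 1 3] L[OF m(2), of 2 3] by (auto simp: z w)
    then have "w 1 = z 1" "w 2 = z 2" "w 3 = z 3" by (auto simp: z w prod_eq_iff)
    moreover have "i = 1 \<or> i = 2 \<or> i = 3" if "i \<in> {1..3}" for i :: nat using that by auto
    ultimately show "\<forall>i\<in>{1..3}. w i = z i" by metis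
  qed
  then show ?thesis
    by (rule denominator_ne_1[where D = 2 and k = 3]) (use half_not_Ints in \<open>auto simp: z_def\<close>)
qed

text \<open>The second and third piece are \<open>(t, t)\<close> and \<open>(0, t)\<close>, up to a reflection when \<open>e = -1\<close>; the fourth
  piece \<open>(t, 1)\<close> lies on the diagonal of the third only for \<open>t = 1 / 2\<close>.\<close>
lemma denominator_rook_and_diagonal:
  assumes m: "(1, 0) \<in> M \<union> uminus ` M" "(0, 1) \<in> M \<union> uminus ` M" "(1, e) \<in> M \<union> uminus ` M"
    and e: "e \<in> {1, -1}"
  shows "denominator M 4 \<noteq> 1"
proof -
  \<comment> \<open>The first and third piece lie on the edge x = a from which the diagonal
    \<open>(1, e)\<close> leads upwards into the board.\<close>
  define a :: real where "a = (if e = 1 then 0 else 1)"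
  define z :: "nat \<Rightarrow> real \<times> real" where
    "z = (\<lambda>i\<in>{1..4}. if i = 1 then (a, 0) else if i = 2 then (1 / 2, 1 / 2)
      else if i = 3 then (a, 1 / 2) else (1 / 2, 1))"
  have z: "z 1 = (a, 0)" "z 2 = (1 / 2, 1 / 2)" "z 3 = (a, 1 / 2)" "z 4 = (1 / 2, 1)"
    by (simp_all add: z_def)
  have ae: "a = 0 \<and> e = 1 \<or> a = 1 \<and> e = -1" using e by (auto simp: a_def)
  have "z \<in> vertices M 4"
  proof (rule verticesI)
    show "z \<in> cube 4" using ae by (auto simp: cube_def z_def)
    note One_nat_def [simp del]
    fix w :: "nat \<Rightarrow> real \<times> real"
    assume X: "\<And>i. i \<in> {1..4} \<Longrightarrow> fst (z i) \<in> {0, 1} \<Longrightarrow> fst (w i) = fst (z i)"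
      and Y: "\<And>i. i \<in> {1..4} \<Longrightarrow> snd (z i) \<in> {0, 1} \<Longrightarrow> snd (w i) = snd (z i)"
      and L: "\<And>c d i j. (c, d) \<in> M \<union> uminus ` M \<Longrightarrow> 1 \<le> i \<Longrightarrow> i < j \<Longrightarrow> j \<le> 4 \<Longrightarrow>
        (fst (z j) - fst (z i)) * of_int d = (snd (z j) - snd (z i)) * of_int c \<Longrightarrow>
        (fst (w j) - fst (w i)) * of_int d = (snd (w j) - snd (w i)) * of_int c"
    have w: "fst (w 1) = a" "snd (w 1) = 0" "fst (w 3) = a" "snd (w 4) = 1"
      using X[of 1] X[of 3] Y[of 1] Y[of 4] ae by (auto simp: z)
    have "(fst (w 2) - a) * of_int e = snd (w 2)" "(fst (w 4) - a) * of_int e = 1 - snd (w 3)"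
      using L[OF m(3), of 1 2] L[OF m(3), of 3 4] ae by (auto simp: z w)
    \<comment> \<open>With these equalities both diagonal equations have the same left side, so the
      common height t satisfies t = 1 - t.\<close>
    moreover have "snd (w 2) = snd (w 3)" "fst (w 2) = fst (w 4)"
      using L[OF m(1), of 2 3] L[OF m(2), of 2 4] by (auto simp: z w)
    ultimately have "w 1 = z 1" "w 2 = z 2" "w 3 = z 3" "w 4 = z 4"
      using ae by (auto simp: z w prod_eq_iff)
    moreover have "i = 1 \<or> i = 2 \<or> i = 3 \<or> i = 4" if "i \<in> {1..4}" for i :: nat using that by auto
    ultimately show "\<forall>i\<in>{1..4}. w i = z i" by metis
  qed
  then show ?thesis
    by (rule denominator_ne_1[where D = 2 and k = 2])
      (use half_not_Ints in \<open>auto simp: z_def a_def\<close>)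
qed

section \<open>The classification\<close>

text \<open>Two pieces already exclude every steep or flat move; among the remaining directions
  coprimality leaves only the rook and diagonal unit moves.\<close>

lemma denominator_1_moves:
  assumes M: "piece M" and den: "\<And>q. q \<ge> 1 \<Longrightarrow> denominator M q = 1"
  shows "M \<union> uminus ` M \<subseteq> {(1, 0), (-1, 0), (0, 1), (0, -1), (1, 1), (-1, -1), (1, -1), (-1, 1)}"
proof
  fix m assume m: "m \<in> M \<union> uminus ` M"
  obtain c d where cd: "m = (c, d)" by fastforce
  have "coprime c d" using M m cd unfolding piece_def by auto
  moreover have "c = 0 \<or> d = 0 \<or> \<bar>c\<bar> = \<bar>d\<bar>"
    using denominator_steep_move[of c d M] denominator_flat_move[of c d M] m cd den[of 2] by fastforce
  moreover have "\<bar>c\<bar> = 1" if "\<bar>c\<bar> = \<bar>d\<bar>"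
    using \<open>coprime c d\<close> that coprime_abs_left_iff[of c d] coprime_abs_right_iff[of "\<bar>c\<bar>" d]
    by (simp flip: that)
  ultimately have "\<bar>c\<bar> = 1 \<and> d = 0 \<or> c = 0 \<and> \<bar>d\<bar> = 1 \<or> \<bar>c\<bar> = 1 \<and> \<bar>d\<bar> = 1"
    by auto
  then show "m \<in> {(1, 0), (-1, 0), (0, 1), (0, -1), (1, 1), (-1, -1), (1, -1), (-1, 1)}"
    unfolding cd by (auto simp: abs_if split: if_splits)
qed

lemma denominator_1_classification:
  assumes M: "piece M" and den: "\<And>q. q \<ge> 1 \<Longrightarrow> denominator M q = 1"
  shows "rook M \<or> semirook M \<or> semibishop M \<or> anassa M"
proof -
  define N where "N = M \<union> uminus ` M"
  have sub: "N \<subseteq> {(1, 0), (-1, 0), (0, 1), (0, -1), (1, 1), (-1, -1), (1, -1), (-1, 1)}"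
    using denominator_1_moves[OF M den] by (simp add: N_def)
  have sym: "- m \<in> N \<longleftrightarrow> m \<in> N" for m
    by (auto simp: N_def image_iff) (metis minus_minus)+
  have neg: "(-1, 0) \<in> N \<longleftrightarrow> (1, 0) \<in> N" "(0, -1) \<in> N \<longleftrightarrow> (0, 1) \<in> N"
    "(-1, -1) \<in> N \<longleftrightarrow> (1, 1) \<in> N" "(-1, 1) \<in> N \<longleftrightarrow> (1, -1) \<in> N"
    using sym[of "(1, 0)"] sym[of "(0, 1)"] sym[of "(1, 1)"] sym[of "(1, -1)"] by auto
  have ne: "N \<noteq> {}" using M by (auto simp: N_def piece_def)
  have diag: "\<not> ((1, 1) \<in> N \<and> (1, -1) \<in> N)"
    using denominator_both_diagonals[of M] den[of 3] unfolding N_def by auto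
  have semiqueen: "\<not> ((1, 0) \<in> N \<and> (0, 1) \<in> N \<and> (1, e) \<in> N)" if "e \<in> {1, -1}" for e
    using denominator_rook_and_diagonal[of M e] den[of 4] that unfolding N_def by auto
  have N: "N = (if (1, 0) \<in> N then {(1, 0), (-1, 0)} else {}) \<union>
      (if (0, 1) \<in> N then {(0, 1), (0, -1)} else {}) \<union>
      (if (1, 1) \<in> N then {(1, 1), (-1, -1)} else {}) \<union>
      (if (1, -1) \<in> N then {(1, -1), (-1, 1)} else {})" (is "N = ?N")
  proof
    show "?N \<subseteq> N" using neg by (simp split del: if_split) auto
    show "N \<subseteq> ?N"
    proof
      fix m assume m: "m \<in> N"
      then have "m = (1, 0) \<or> m = (-1, 0) \<or> m = (0, 1) \<or> m = (0, -1) \<or>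
          m = (1, 1) \<or> m = (-1, -1) \<or> m = (1, -1) \<or> m = (-1, 1)"
        using sub by blast
      then show "m \<in> ?N" using m neg by (elim disjE) simp_all
    qed
  qed
  \<comment> \<open>Of the 16 sets of directions, discarding the empty one, those with both
    diagonals and those with both rook moves and a diagonal leaves these nine.\<close>
  consider "N = {(1, 0), (-1, 0)}" | "N = {(0, 1), (0, -1)}" | "N = {(1, 0), (-1, 0), (0, 1), (0, -1)}"
    | "N = {(1, 1), (-1, -1)}" | "N = {(1, -1), (-1, 1)}"
    | "N = {(1, 0), (-1, 0), (1, 1), (-1, -1)}" | "N = {(1, 0), (-1, 0), (1, -1), (-1, 1)}"
    | "N = {(0, 1), (0, -1), (1, 1), (-1, -1)}" | "N = {(0, 1), (0, -1), (1, -1), (-1, 1)}"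
    using N ne diag semiqueen[of 1] semiqueen[of "-1"]
    by (cases "(1, 0) \<in> N"; cases "(0, 1) \<in> N"; cases "(1, 1) \<in> N"; cases "(1, -1) \<in> N")
      (simp_all add: insert_commute)
  then show ?thesis
    unfolding rook_def semirook_def semibishop_def anassa_def same_piece_def N_def[symmetric]
    by cases (simp_all add: insert_commute)
qed

text \<open>Single moves inherit rounding and encoding from a pair: the semirook from the rook, the
  semibishop from an anassa. \<open>N\<close> is the representative with the standard signs.\<close>

lemma classified_cases:
  assumes "rook M \<or> semirook M \<or> semibishop M \<or> anassa M"
  obtains N where "same_piece M N" "roundable N" "order_encodable N"
proof -
  have rook: "roundable N \<and> order_encodable N" if "N \<subseteq> {(1, 0), (0, 1)}" for N
    by (intro conjI roundable_subset[OF roundable_rook that] order_encodable_subset[OF order_encodable_rook that])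
  have anassa: "roundable N \<and> order_encodable N"
    if "N \<subseteq> {a, b}" "a \<in> {(1, 0), (0, 1)}" "b \<in> {(1, 1), (1, -1)}" for N a b
    by (intro conjI roundable_subset[OF roundable_anassa[OF that(2,3)] that(1)]
        order_encodable_subset[OF order_encodable_anassa[OF that(2,3)] that(1)])
  have "\<exists>N. same_piece M N \<and> roundable N \<and> order_encodable N"
    using assms
  proof (elim disjE)
    assume "rook M"
    then show ?thesis using rook[of "{(1, 0), (0, 1)}"] by (auto simp: rook_def)
  next
    assume "semirook M"
    then show ?thesis using rook[of "{(1, 0)}"] rook[of "{(0, 1)}"] by (auto simp: semirook_def)
  next
    assume "semibishop M"
    then show ?thesis
      using anassa[of "{(1, 1)}" "(1, 0)" "(1, 1)"] anassa[of "{(1, -1)}" "(1, 0)" "(1, -1)"]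
      by (auto simp: semibishop_def)
  next
    assume "anassa M"
    then obtain a b where "a \<in> {(1, 0), (0, 1)}" "b \<in> {(1, 1), (1, -1)}" "same_piece M {a, b}"
      unfolding anassa_def by blast
    then show ?thesis using anassa[of "{a, b}" a b] by blast
  qed
  then show thesis using that by blast
qed

theorem theorem2p3:
  fixes M :: "move set"
  assumes "piece M"
  shows "((\<forall>q\<ge>1. denominator M q = 1) \<longleftrightarrow>
            rook M \<or> semirook M \<or> semibishop M \<or> anassa M) \<and>
         (rook M \<or> semirook M \<or> semibishop M \<or> anassa M \<longrightarrow>
            (\<forall>q\<ge>1. \<exists>p :: rat poly. \<forall>n\<ge>1.
               of_nat (placement_count M q n) = poly p (of_nat n)))"
proof -
  have "rook M \<or> semirook M \<or> semibishop M \<or> anassa M" if "\<forall>q\<ge>1. denominator M q = 1"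
    using denominator_1_classification[OF assms] that by blast
  moreover have "denominator M q = 1" "q \<ge> 1 \<Longrightarrow> \<exists>p :: rat poly. \<forall>n. of_nat (placement_count M q n) = poly p (of_nat n)"
    if four: "rook M \<or> semirook M \<or> semibishop M \<or> anassa M" for q
  proof -
    obtain N where N: "same_piece M N" "roundable N" "order_encodable N"
      using classified_cases[OF four] .
    show "denominator M q = 1"
      using denominator_same_piece[OF N(1)] roundable_denominator[OF N(2)] by simp
    show "\<exists>p :: rat poly. \<forall>n. of_nat (placement_count M q n) = poly p (of_nat n)" if "q \<ge> 1"
      using order_encodable_polynomial[OF N(3) that] placement_count_same_piece[OF N(1)] by simp
  qed
  ultimately show ?thesis by blast
qed

end
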